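(* Let $(X,\Delta)$ be a metric space and let $\mathcal{U}=(U_\alpha)_{\alpha\in\kappa}$ be an open cover of $X$ with Lebesgue number $L>0$ and multiplicity $M\in\mathbb{N}$, $M\ge 1$. Let $(\lambda_\alpha)_{\alpha\in\kappa}$ be the standard partition of unity subordinate to $\mathcal{U}$. Then $$\forall \alpha\in\kappa:\ \forall x,y\in X:\quad |\lambda_\alpha(x)-\lambda_\alpha(y)|\le \frac{\max(1,M-1)}{L}\,\Delta(x,y).$$ If, additionally, $X$ has the approximate midpoint property, then $$\forall \alpha\in\kappa:\ \forall x,y\in X:\quad |\lambda_\alpha(x)-\lambda_\alpha(y)|\le \frac{M-1}{2L}\,\Delta(x,y).$$ The same bounds hold with $\lambda_\alpha$ replaced by an arbitrary partial sum $\lambda_\mu:=\sum_{\alpha\in\mu}\lambda_\alpha$, $\mu\subseteq\kappa$. Moreover, these bounds are the best possible for the standard partition of unity: for all integers $M\ge 1$ and reals $L>0$, and every real $C<\max(1,M-1)/L$, there are a metric space $X$ and an open cover $\mathcal{U}$ of $X$ with Lebesgue number $L$ and multiplicity $M$ such that for the standard partition of unity there are $\alpha\in\kappa$ and $x,y\in X$ with $|\lambda_\alpha(x)-\lambda_\alpha(y)|>C\,\Delta(x,y)$; and for every real $C<(M-1)/(2L)$ there are such $X$ and $\mathcal{U}$ where $X$ in addition has the approximate midpoint property.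
   Context: An open cover $\mathcal{U}=(U_\alpha)_{\alpha\in\kappa}$ of $X$ is an indexed family of open sets with union $X$. It has multiplicity $M$ if each point of $X$ lies in $U_\alpha$ for at most $M$ indices $\alpha$ (repetitions of the same set under different indices are counted separately). A number $L>0$ is a Lebesgue number of $\mathcal{U}$ if for every $x\in X$ there is $\alpha\in\kappa$ with $\mathcal{B}(x,L)\subseteq U_\alpha$, where $\mathcal{B}(x,L)$ is the open ball. A metric space $X$ has the approximate midpoint property if for all $x,y\in X$ and $\epsilon>0$ there is $z\in X$ with $\max(\Delta(x,z),\Delta(z,y))\le \Delta(x,y)/2+\epsilon$. A partition of unity over $X$ is a family $(\lambda_\alpha)_{\alpha\in\kappa}$ of continuous functions $\lambda_\alpha:X\to[0,\infty)$ such that at each point only finitely many are nonzero and their sum is $1$; it is subordinate to $\mathcal{U}$ if $\{\lambda_\alpha>0\}\subseteq U_\alpha$ for every $\alpha\in\kappa$. Let $\delta_\alpha(x):=\Delta(x,X\setminus U_\alpha)=\inf_{y\in X\setminus U_\alpha}\Delta(x,y)$ (equal to $\infty$ if $U_\alpha=X$). The standard partition of unity is $$\lambda_\alpha(x)=\frac{\delta_\alpha(x)}{\sum_{\beta\in\kappa}\delta_\beta(x)},\qquad \alpha\in\kappa,$$ with the following convention if $U_\alpha=X$ for some $\alpha$: then $\lambda_\alpha$ is the constant $1/N$ for each $\alpha$ with $U_\alpha=X$, where $N$ is the number of such indices, and all other $\lambda_\alpha$ are zero. *)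

theory Defs
  imports "HOL-Analysis.Analysis"
begin

definition open_cover :: "'a set \<Rightarrow> ('a \<Rightarrow> 'a \<Rightarrow> real) \<Rightarrow> 'k set \<Rightarrow> ('k \<Rightarrow> 'a set) \<Rightarrow> bool" where
  "open_cover X d K U \<longleftrightarrow>
     (\<forall>\<alpha>\<in>K. openin (Metric_space.mtopology X d) (U \<alpha>)) \<and> (\<Union>\<alpha>\<in>K. U \<alpha>) = X"

definition has_multiplicity :: "'a set \<Rightarrow> 'k set \<Rightarrow> ('k \<Rightarrow> 'a set) \<Rightarrow> nat \<Rightarrow> bool" where
  "has_multiplicity X K U M \<longleftrightarrow>
     (\<forall>x\<in>X. finite {\<alpha>\<in>K. x \<in> U \<alpha>} \<and> card {\<alpha>\<in>K. x \<in> U \<alpha>} \<le> M)"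

definition lebesgue_number ::
    "'a set \<Rightarrow> ('a \<Rightarrow> 'a \<Rightarrow> real) \<Rightarrow> 'k set \<Rightarrow> ('k \<Rightarrow> 'a set) \<Rightarrow> real \<Rightarrow> bool" where
  "lebesgue_number X d K U L \<longleftrightarrow>
     0 < L \<and> (\<forall>x\<in>X. \<exists>\<alpha>\<in>K. Metric_space.mball X d x L \<subseteq> U \<alpha>)"

definition approx_midpoint_property :: "'a set \<Rightarrow> ('a \<Rightarrow> 'a \<Rightarrow> real) \<Rightarrow> bool" where
  "approx_midpoint_property X d \<longleftrightarrow>
     (\<forall>x\<in>X. \<forall>y\<in>X. \<forall>\<epsilon>>0. \<exists>z\<in>X. max (d x z) (d z y) \<le> d x y / 2 + \<epsilon>)"

(* The infimum is taken in ennreal, so the value is \<infinity> exactly when X - V is empty. *)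
definition dist_compl :: "'a set \<Rightarrow> ('a \<Rightarrow> 'a \<Rightarrow> real) \<Rightarrow> 'a set \<Rightarrow> 'a \<Rightarrow> ennreal" where
  "dist_compl X d V x = (INF y\<in>X - V. ennreal (d x y))"

(* In the last branch no member of the cover is X, so every dist_compl is finite and
   enn2real loses nothing.  K may be infinite, hence infsum; under finite multiplicity
   only finitely many summands are nonzero at each point. *)
definition std_pou ::
    "'a set \<Rightarrow> ('a \<Rightarrow> 'a \<Rightarrow> real) \<Rightarrow> 'k set \<Rightarrow> ('k \<Rightarrow> 'a set) \<Rightarrow> 'k \<Rightarrow> 'a \<Rightarrow> real" where
  "std_pou X d K U \<alpha> x =
     (if \<exists>\<beta>\<in>K. U \<beta> = X
      then (if U \<alpha> = X then 1 / real (card {\<beta>\<in>K. U \<beta> = X}) else 0)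
      else enn2real (dist_compl X d (U \<alpha>) x) /
             (\<Sum>\<^sub>\<infinity>\<beta>\<in>K. enn2real (dist_compl X d (U \<beta>) x)))"

definition std_pou_partial_sum ::
    "'a set \<Rightarrow> ('a \<Rightarrow> 'a \<Rightarrow> real) \<Rightarrow> 'k set \<Rightarrow> ('k \<Rightarrow> 'a set) \<Rightarrow> 'k set \<Rightarrow> 'a \<Rightarrow> real" where
  "std_pou_partial_sum X d K U \<mu> x = (\<Sum>\<^sub>\<infinity>\<alpha>\<in>\<mu>. std_pou X d K U \<alpha> x)"

end

theory Submission imports Defs begin

text \<open>Suppose first that no member of the cover is the whole space. Write \<open>\<delta> \<alpha> x\<close> for the
distance from \<open>x\<close> to the complement of \<open>U \<alpha>\<close>. Each of these functions is 1-Lipschitz, it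
vanishes off \<open>U \<alpha>\<close>, and at every point one of them is at least \<open>L\<close>. Split the total of the
\<open>\<delta> \<alpha>\<close> into the part \<open>a\<close> indexed by \<open>\<mu>\<close> and the part \<open>b\<close> indexed by its complement, so that
the partial sum is \<open>a / (a + b)\<close>, and write \<open>a'\<close> and \<open>b'\<close> for the values at \<open>y\<close>.

Upper bounds. If \<open>a\<close> exceeds \<open>a'\<close> by at most \<open>t\<close>, and \<open>b'\<close> exceeds \<open>b\<close> by at most \<open>t\<close>, and
both totals are at least \<open>c\<close>, then the quotients differ by at most \<open>t / c\<close>
(\<open>normalized_diff_le\<close>). Only the sets containing \<open>x\<close> contribute to the excess of \<open>a\<close>, and only
those containing \<open>y\<close> to the excess of \<open>b'\<close>; counting them gives \<open>t = (M - 1) d(x, y)\<close> unless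
all \<open>M\<close> available indices lie on one side. If they do so at one of the points, then
the weight of the other side vanishes there and the bound survives. They cannot do so at both
points when \<open>d(x, y) < L\<close>, because a set containing the \<open>L\<close>-ball around \<open>x\<close> also contains \<open>y\<close>
(\<open>partial_sum_local_increase\<close>). For \<open>d(x, y) \<ge> L\<close> it is enough that partial sums lie in the
unit interval. This yields the first bound with \<open>c = L\<close>.

Approximate midpoints improve the constant twice. They raise the total to
\<open>2 * L\<close>: walking from \<open>x\<close> in small steps towards the complement of a set that is deep at \<open>x\<close>,
at the first place where this set is no longer \<open>L\<close>-deep another one must be, and the two depths
at \<open>x\<close> add up to \<open>2 * L\<close> (\<open>total_ge_approx_midpoint\<close>). They also make a Lipschitz
bound at distances below \<open>L\<close> a global one (\<open>approx_midpoint_Lipschitz_of_local\<close>), so the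
constant 1 in \<open>max 1 (M - 1)\<close> disappears.

Sharpness. The bound is nearly attained where one set is alone at \<open>x\<close>, with
nearly the least possible total, and \<open>M - 1\<close> further sets begin immediately next to \<open>x\<close>. Three collinear points
realise this with total close to \<open>L\<close>, and the half lines \<open>{..<2 * L}\<close> and \<open>M - 1\<close> copies of
\<open>{0<..}\<close> in the real line with total \<open>2 * L\<close>. For constant \<open>1 / L\<close> two points at distance \<open>L\<close>
suffice.\<close>

section \<open>Depth of a point in a set\<close>

definition depth :: "'a set \<Rightarrow> ('a \<Rightarrow> 'a \<Rightarrow> real) \<Rightarrow> 'a set \<Rightarrow> 'a \<Rightarrow> real" where
  "depth X d V x = enn2real (dist_compl X d V x)"

lemma depth_nonneg: "0 \<le> depth X d V x"
  by (simp add: depth_def)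

context Metric_space
begin

lemma depth_le:
  assumes "x \<in> M" "y \<in> M - V"
  shows "depth M d V x \<le> d x y"
proof -
  have "dist_compl M d V x \<le> ennreal (d x y)"
    unfolding dist_compl_def using assms(2) by (rule INF_lower)
  then show ?thesis
    by (simp add: depth_def enn2real_leI)
qed

lemma depth_greatest:
  assumes "M - V \<noteq> {}" and "\<And>y. y \<in> M - V \<Longrightarrow> c \<le> d x y"
  shows "c \<le> depth M d V x"
proof -
  obtain y where y: "y \<in> M - V" using assms(1) by blast
  have "dist_compl M d V x \<le> ennreal (d x y)"
    unfolding dist_compl_def using y by (rule INF_lower)
  then have "dist_compl M d V x < \<infinity>"
    using le_less_trans by force
  moreover have "ennreal c \<le> dist_compl M d V x"
    unfolding dist_compl_def by (rule INF_greatest) (simp add: assms(2) ennreal_leI)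
  ultimately show ?thesis
    unfolding depth_def by (simp add: ennreal_le_iff2 enn2real_positive_iff)
      (metis enn2real_mono enn2real_nonneg enn2real_ennreal infinity_ennreal_def linorder_le_cases order_trans)
qed

lemma depth_eqI:
  assumes "x \<in> M" "y \<in> M - V" "d x y = c" and "\<And>z. z \<in> M - V \<Longrightarrow> c \<le> d x z"
  shows "depth M d V x = c"
  using depth_le[OF assms(1,2)] depth_greatest[of V c x] assms by force

lemma depth_outside:
  assumes "x \<in> M" "x \<notin> V"
  shows "depth M d V x = 0"
  using depth_le[of x x V] depth_nonneg[of M d V x] assms by simp

lemma depth_Lipschitz:
  assumes "x \<in> M" "y \<in> M" "M - V \<noteq> {}"
  shows "depth M d V x \<le> depth M d V y + d x y"
proof -
  have "depth M d V x - d x y \<le> depth M d V y"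
  proof (rule depth_greatest[OF assms(3)])
    fix z assume z: "z \<in> M - V"
    show "depth M d V x - d x y \<le> d y z"
      using depth_le[OF assms(1) z] triangle[of x y z] assms z by auto
  qed
  then show ?thesis by simp
qed

lemma depth_ge_of_mball:
  assumes "x \<in> M" "M - V \<noteq> {}" "mball x r \<subseteq> V"
  shows "r \<le> depth M d V x"
proof (rule depth_greatest[OF assms(2)])
  fix y assume "y \<in> M - V"
  then have "y \<notin> mball x r" using assms(3) by blast
  then show "r \<le> d x y" using \<open>y \<in> M - V\<close> assms(1) by (auto simp: in_mball)
qed

end

lemma std_pou_proper:
  assumes "\<nexists>\<beta>. \<beta> \<in> K \<and> U \<beta> = X"
  shows "std_pou X d K U \<alpha> x = depth X d (U \<alpha>) x / (\<Sum>\<^sub>\<infinity>\<beta>\<in>K. depth X d (U \<beta>) x)"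
  using assms by (auto simp: std_pou_def depth_def)

lemma std_pou_partial_sum_singleton:
  "std_pou_partial_sum X d K U {\<alpha>} x = std_pou X d K U \<alpha> x"
  by (simp add: std_pou_partial_sum_def)

section \<open>Chains in spaces with approximate midpoints\<close>

text \<open>Iterated halving. The midpoint errors do not accumulate in the length of a single step: the
error of a midpoint is itself halved at each later level, so half of the tolerance is left for
the recursion.\<close>

lemma approx_midpoint_dyadic_chain:
  assumes mid: "approx_midpoint_property X d" and "0 < \<epsilon>" "x \<in> X" "y \<in> X"
  shows "\<exists>f. f 0 = x \<and> f (2 ^ n) = y \<and> (\<forall>i. f i \<in> X) \<and>
           (\<forall>i < 2 ^ n. d (f i) (f (Suc i)) \<le> d x y / 2 ^ n + \<epsilon>)"
  using assms(2-)
proof (induction n arbitrary: x y \<epsilon>)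
  case 0
  show ?case
    by (rule exI[of _ "\<lambda>i. if i = 0 then x else y"]) (use 0 in auto)
next
  case (Suc n)
  have e: "0 < \<epsilon> / 2" using Suc.prems by simp
  obtain z where z: "z \<in> X" "max (d x z) (d z y) \<le> d x y / 2 + \<epsilon> / 2"
    using mid Suc.prems e unfolding approx_midpoint_property_def by meson
  obtain g where g: "g 0 = x" "g (2 ^ n) = z" "\<And>i. g i \<in> X"
      "\<And>i. i < 2 ^ n \<Longrightarrow> d (g i) (g (Suc i)) \<le> d x z / 2 ^ n + \<epsilon> / 2"
    using Suc.IH[OF e Suc.prems(2) z(1)] by blast
  obtain h where h: "h 0 = z" "h (2 ^ n) = y" "\<And>i. h i \<in> X"
      "\<And>i. i < 2 ^ n \<Longrightarrow> d (h i) (h (Suc i)) \<le> d z y / 2 ^ n + \<epsilon> / 2"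
    using Suc.IH[OF e z(1) Suc.prems(3)] by blast
  have half: "u / 2 ^ n + \<epsilon> / 2 \<le> d x y / 2 ^ Suc n + \<epsilon>" if "u \<le> d x y / 2 + \<epsilon> / 2" for u
  proof -
    have "u / 2 ^ n \<le> (d x y / 2 + \<epsilon> / 2) / 2 ^ n"
      using that by (simp add: divide_right_mono)
    also have "\<dots> = d x y / 2 ^ Suc n + (\<epsilon> / 2) / 2 ^ n"
      by (simp add: add_divide_distrib)
    also have "(\<epsilon> / 2) / 2 ^ n \<le> \<epsilon> / 2"
      using e by (simp add: field_simps)
    finally show ?thesis by simp
  qed
  define f where "f i = (if i \<le> 2 ^ n then g i else h (i - 2 ^ n))" for i
  have "d (f i) (f (Suc i)) \<le> d x y / 2 ^ Suc n + \<epsilon>" if i: "i < 2 ^ Suc n" for i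
  proof (cases "i < 2 ^ n")
    case True
    then have "d (f i) (f (Suc i)) \<le> d x z / 2 ^ n + \<epsilon> / 2"
      using g(4) by (simp add: f_def)
    then show ?thesis using half[of "d x z"] z(2) by simp
  next
    case False
    then have "f i = h (i - 2 ^ n)" "f (Suc i) = h (Suc (i - 2 ^ n))"
      using g(2) h(1) by (auto simp: f_def Suc_diff_le)
    moreover have "i - 2 ^ n < 2 ^ n" using i False by auto
    ultimately have "d (f i) (f (Suc i)) \<le> d z y / 2 ^ n + \<epsilon> / 2"
      using h(4) by simp
    then show ?thesis using half[of "d z y"] z(2) by simp
  qed
  moreover have "f 0 = x" "f (2 ^ Suc n) = y" "\<And>i. f i \<in> X"
    using g(1,3) h(2,3) by (auto simp: f_def)
  ultimately show ?case by blast
qed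

text \<open>The length of the chain is controlled through \<open>n * h\<close>, with a uniform step bound \<open>h\<close>, which
makes the distance travelled up to a given index computable from the index alone.\<close>

lemma approx_midpoint_fine_chain:
  assumes mid: "approx_midpoint_property X d" and "0 < \<epsilon>" "x \<in> X" "y \<in> X"
  obtains f :: "nat \<Rightarrow> 'a" and n h where "f 0 = x" "f n = y" "\<And>i. f i \<in> X"
    "\<And>i. i < n \<Longrightarrow> d (f i) (f (Suc i)) \<le> h" "h \<le> \<epsilon>" "real n * h \<le> d x y + \<epsilon>"
proof -
  obtain k where k: "2 * d x y / \<epsilon> < 2 ^ k"
    using real_arch_pow[of 2 "2 * d x y / \<epsilon>"] by auto
  define h where "h = d x y / 2 ^ k + \<epsilon> / 2 / 2 ^ k"
  have "0 < \<epsilon> / 2 / 2 ^ k" using assms(2) by simp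
  from approx_midpoint_dyadic_chain[OF mid this assms(3,4), of k]
  obtain f where f: "f 0 = x" "f (2 ^ k) = y" "\<And>i. f i \<in> X"
      "\<And>i. i < 2 ^ k \<Longrightarrow> d (f i) (f (Suc i)) \<le> h"
    unfolding h_def by blast
  have "d x y / 2 ^ k \<le> \<epsilon> / 2"
    using k assms(2) by (simp add: field_simps)
  moreover have "\<epsilon> / 2 / 2 ^ k \<le> \<epsilon> / 2"
    using assms(2) by (simp add: field_simps)
  ultimately have "h \<le> \<epsilon>" unfolding h_def by linarith
  moreover have "real (2 ^ k) * h \<le> d x y + \<epsilon>"
    using assms(2) by (simp add: h_def field_simps)
  ultimately show thesis using f that by blast
qed

lemma (in Metric_space) chain_dist_le:
  assumes "\<And>i. f i \<in> M" "\<And>i. i < n \<Longrightarrow> d (f i) (f (Suc i)) \<le> h" "i \<le> j" "j \<le> n"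
  shows "d (f i) (f j) \<le> (real j - real i) * h"
  using assms(3,4)
proof (induction j rule: dec_induct)
  case base
  then show ?case using assms(1) by simp
next
  case (step j)
  have "d (f i) (f (Suc j)) \<le> d (f i) (f j) + d (f j) (f (Suc j))"
    using triangle assms(1) by blast
  also have "\<dots> \<le> (real j - real i) * h + h"
    using step assms(2)[of j] by (intro add_mono) auto
  finally show ?case by (simp add: algebra_simps)
qed

text \<open>The local bound is summed along a chain of short steps whose total length is almost
\<open>d x y\<close>.\<close>

lemma approx_midpoint_Lipschitz_of_local:
  fixes g :: "'a \<Rightarrow> real"
  assumes mid: "approx_midpoint_property X d" and "0 < r" "0 \<le> C"
    and loc: "\<And>x y. x \<in> X \<Longrightarrow> y \<in> X \<Longrightarrow> d x y < r \<Longrightarrow> \<bar>g x - g y\<bar> \<le> C * d x y"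
    and xy: "x \<in> X" "y \<in> X"
  shows "\<bar>g x - g y\<bar> \<le> C * d x y"
proof (rule field_le_epsilon)
  fix e :: real assume e: "0 < e"
  define \<epsilon> where "\<epsilon> = min (r / 2) (e / (C + 1))"
  have \<epsilon>: "0 < \<epsilon>" using assms(2,3) e by (simp add: \<epsilon>_def)
  obtain f n h where f: "f 0 = x" "f n = y" "\<And>i. f i \<in> X"
    "\<And>i. i < n \<Longrightarrow> d (f i) (f (Suc i)) \<le> h" "h \<le> \<epsilon>" "real n * h \<le> d x y + \<epsilon>"
    using approx_midpoint_fine_chain[OF mid \<epsilon> xy] by blast
  have "h < r" using f(5) assms(2) by (simp add: \<epsilon>_def)
  have "j \<le> n \<Longrightarrow> \<bar>g x - g (f j)\<bar> \<le> C * (real j * h)" for j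
  proof (induction j)
    case 0
    then show ?case using f(1) by simp
  next
    case (Suc j)
    then have dj: "d (f j) (f (Suc j)) \<le> h" using f(4) by simp
    then have "\<bar>g (f j) - g (f (Suc j))\<bar> \<le> C * d (f j) (f (Suc j))"
      using loc f(3) \<open>h < r\<close> by force
    also have "\<dots> \<le> C * h" using dj assms(3) by (rule mult_left_mono)
    finally show ?case using Suc by (simp add: algebra_simps)
  qed
  from this[of n] have "\<bar>g x - g y\<bar> \<le> C * (real n * h)" using f(2) by simp
  also have "\<dots> \<le> C * (d x y + \<epsilon>)" using f(6) assms(3) by (rule mult_left_mono)
  also have "\<dots> \<le> C * d x y + (C + 1) * \<epsilon>" using \<epsilon> by (simp add: algebra_simps)
  also have "(C + 1) * \<epsilon> \<le> (C + 1) * (e / (C + 1))"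
    using assms(3) by (intro mult_left_mono) (auto simp: \<epsilon>_def)
  also have "\<dots> = e" using assms(3) by simp
  finally show "\<bar>g x - g y\<bar> \<le> C * d x y + e" by simp
qed

section \<open>The Lipschitz bounds\<close>

text \<open>The difference can be expanded either through \<open>a - a'\<close> and the change of the totals or
through \<open>b' - b\<close> and the change of the totals. The two changes of total enter with opposite
signs, so one of the expansions has only the excess, at most \<open>t\<close>, to estimate. Being able to choose
between them avoids the factor 2 of the usual quotient estimate.\<close>

lemma normalized_diff_le:
  fixes a b a' b' c t :: real
  assumes "0 \<le> a" "0 \<le> b" "0 \<le> a'" "0 \<le> b'" "0 < c" "c \<le> a + b" "c \<le> a' + b'"
    and "0 \<le> t" "a - a' \<le> t" "b' - b \<le> t"
  shows "a / (a + b) - a' / (a' + b') \<le> t / c"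
proof -
  define S S' where "S = a + b" "S' = a' + b'"
  have S: "0 < S" "0 < S'" "c \<le> S" "c \<le> S'" using assms by (auto simp: S_S'_def)
  have eq: "a / S - a' / S' = (a * S' - a' * S) / (S * S')"
    using S by (simp add: field_simps)
  show ?thesis
  proof (cases "S' \<le> S")
    case True
    \<comment> \<open>Here the change of the totals helps in the expansion through the first excess.\<close>
    have "a * S' \<le> a * S" using True assms by (simp add: mult_left_mono)
    moreover have "(a - a') * S \<le> t * S" using assms S by (simp add: mult_right_mono)
    ultimately have "a * S' - a' * S \<le> t * S" by (simp add: algebra_simps)
    then have "a / S - a' / S' \<le> t * S / (S * S')"
      unfolding eq by (rule divide_right_mono) (use S in simp)
    also have "\<dots> = t / S'" using S by simp
    also have "\<dots> \<le> t / c" using S assms by (simp add: frac_le)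
    finally show ?thesis by (simp add: S_S'_def)
  next
    case False
    have "b' * S \<le> b' * S'" using False assms by (simp add: mult_left_mono)
    moreover have "(b' - b) * S' \<le> t * S'" using assms S by (simp add: mult_right_mono)
    moreover have "a * S' - a' * S = b' * S - b * S'" by (simp add: S_S'_def algebra_simps)
    ultimately have "a * S' - a' * S \<le> t * S'" by (simp add: algebra_simps)
    then have "a / S - a' / S' \<le> t * S' / (S * S')"
      unfolding eq by (rule divide_right_mono) (use S in simp)
    also have "\<dots> = t / S" using S by simp
    also have "\<dots> \<le> t / c" using S assms by (simp add: frac_le)
    finally show ?thesis by (simp add: S_S'_def)
  qed
qed

text \<open>Covers without a member equal to the whole space, so that all depths are finite and the
partition of unity is the quotient of a depth by the sum of all depths.\<close>

locale proper_cover = Metric_space X d for X :: "'a set" and d +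
  fixes K :: "'k set" and U :: "'k \<Rightarrow> 'a set" and L :: real and M :: nat
  assumes lebesgue: "lebesgue_number X d K U L"
    and multiplicity: "has_multiplicity X K U M"
    and proper: "\<And>\<alpha>. \<alpha> \<in> K \<Longrightarrow> X - U \<alpha> \<noteq> {}"
begin

abbreviation \<delta> :: "'k \<Rightarrow> 'a \<Rightarrow> real" where
  "\<delta> \<alpha> x \<equiv> depth X d (U \<alpha>) x"

definition active :: "'a \<Rightarrow> 'k set" where
  "active x = {\<alpha> \<in> K. x \<in> U \<alpha>}"

definition weight :: "'k set \<Rightarrow> 'a \<Rightarrow> real" where
  "weight \<mu> x = (\<Sum>\<alpha>\<in>\<mu> \<inter> active x. \<delta> \<alpha> x)"

lemma L_pos: "0 < L"
  using lebesgue by (simp add: lebesgue_number_def)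

lemma finite_active: "x \<in> X \<Longrightarrow> finite (active x)"
  and card_active: "x \<in> X \<Longrightarrow> card (active x) \<le> M"
  using multiplicity by (auto simp: has_multiplicity_def active_def)

lemma card_inter_active: "x \<in> X \<Longrightarrow> card (\<mu> \<inter> active x) \<le> M"
  using card_mono[OF finite_active, of x "\<mu> \<inter> active x"] card_active[of x] by simp

lemma active_subset_of_card_eq:
  assumes "x \<in> X" "card (\<mu> \<inter> active x) = M"
  shows "active x \<subseteq> \<mu>"
proof -
  have "\<mu> \<inter> active x = active x"
    using assms card_active[OF assms(1)] finite_active[OF assms(1)]
    by (intro card_seteq) auto
  then show ?thesis by blast
qed

lemma inactive_depth:
  assumes "x \<in> X" "\<alpha> \<in> K" "\<alpha> \<notin> active x"
  shows "\<delta> \<alpha> x = 0"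
  using assms by (intro depth_outside) (auto simp: active_def)

lemma ex_deep:
  assumes "x \<in> X"
  obtains \<alpha> where "\<alpha> \<in> active x" "L \<le> \<delta> \<alpha> x"
proof -
  obtain \<alpha> where \<alpha>: "\<alpha> \<in> K" "mball x L \<subseteq> U \<alpha>"
    using lebesgue assms by (auto simp: lebesgue_number_def)
  then have "L \<le> \<delta> \<alpha> x" by (intro depth_ge_of_mball assms proper)
  moreover have "\<alpha> \<in> active x" using \<alpha> L_pos assms by (auto simp: active_def)
  ultimately show thesis using that by blast
qed

lemma weight_nonneg: "0 \<le> weight \<mu> x"
  unfolding weight_def by (intro sum_nonneg depth_nonneg)

lemma weight_disjoint_active: "\<mu> \<inter> active x = {} \<Longrightarrow> weight \<mu> x = 0"
  by (simp add: weight_def)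

text \<open>The index set \<open>A\<close> need not consist of indices active at \<open>x\<close>: in the comparison of two points
it will be the set of indices active at the other point.\<close>

lemma sum_depth_le_weight:
  assumes "x \<in> X" "finite A" "A \<subseteq> \<mu>" "\<mu> \<subseteq> K"
  shows "(\<Sum>\<alpha>\<in>A. \<delta> \<alpha> x) \<le> weight \<mu> x"
proof -
  have "(\<Sum>\<alpha>\<in>A. \<delta> \<alpha> x) = (\<Sum>\<alpha>\<in>A \<inter> active x. \<delta> \<alpha> x)"
    using assms inactive_depth by (intro sum.mono_neutral_right) auto
  also have "\<dots> \<le> weight \<mu> x"
    unfolding weight_def using assms finite_active depth_nonneg by (intro sum_mono2) auto
  finally show ?thesis .
qed

lemma weight_split:
  assumes "x \<in> X" "\<mu> \<subseteq> K"
  shows "weight K x = weight \<mu> x + weight (K - \<mu>) x"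
proof -
  have "K \<inter> active x = (\<mu> \<inter> active x) \<union> ((K - \<mu>) \<inter> active x)" using assms by blast
  then show ?thesis
    unfolding weight_def using finite_active[OF assms(1)]
    by (simp add: sum.union_disjoint[symmetric] Int_Un_distrib2)
       (subst sum.union_disjoint[symmetric]; auto)
qed

lemma infsum_depth:
  assumes "x \<in> X" "\<mu> \<subseteq> K"
  shows "(\<Sum>\<^sub>\<infinity>\<alpha>\<in>\<mu>. \<delta> \<alpha> x / c) = weight \<mu> x / c"
proof -
  have "(\<Sum>\<^sub>\<infinity>\<alpha>\<in>\<mu>. \<delta> \<alpha> x / c) = (\<Sum>\<^sub>\<infinity>\<alpha>\<in>\<mu> \<inter> active x. \<delta> \<alpha> x / c)"
    using assms inactive_depth by (intro infsum_cong_neutral) auto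
  also have "\<dots> = weight \<mu> x / c"
    using finite_active[OF assms(1)] by (simp add: weight_def sum_divide_distrib)
  finally show ?thesis .
qed

lemma partial_sum_eq_weight:
  assumes "x \<in> X" "\<mu> \<subseteq> K"
  shows "std_pou_partial_sum X d K U \<mu> x = weight \<mu> x / weight K x"
proof -
  have "\<nexists>\<beta>. \<beta> \<in> K \<and> U \<beta> = X" using proper by blast
  then have "std_pou X d K U \<alpha> x = \<delta> \<alpha> x / weight K x" for \<alpha>
    using infsum_depth[OF assms(1) subset_refl, of 1] by (simp add: std_pou_proper)
  then show ?thesis
    unfolding std_pou_partial_sum_def using infsum_depth[OF assms] by simp
qed

lemma total_ge: "x \<in> X \<Longrightarrow> L \<le> weight K x"
proof -
  assume x: "x \<in> X"
  obtain \<alpha> where \<alpha>: "\<alpha> \<in> active x" "L \<le> \<delta> \<alpha> x" using ex_deep[OF x] by blast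
  then have "\<delta> \<alpha> x \<le> weight K x"
    using sum_depth_le_weight[OF x, of "{\<alpha>}" K] by (simp add: active_def)
  then show ?thesis using \<alpha> by simp
qed

text \<open>Only indices active at the first point can lose weight, each at most \<open>d x y\<close>.\<close>

lemma weight_diff_le:
  assumes "x \<in> X" "y \<in> X" "\<mu> \<subseteq> K"
  shows "weight \<mu> x - weight \<mu> y \<le> real (card (\<mu> \<inter> active x)) * d x y"
proof -
  have "weight \<mu> x \<le> (\<Sum>\<alpha>\<in>\<mu> \<inter> active x. \<delta> \<alpha> y + d x y)"
    unfolding weight_def
  proof (rule sum_mono)
    fix \<alpha> assume "\<alpha> \<in> \<mu> \<inter> active x"
    then show "\<delta> \<alpha> x \<le> \<delta> \<alpha> y + d x y"
      using depth_Lipschitz assms(1,2) proper by (simp add: active_def)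
  qed
  also have "\<dots> = (\<Sum>\<alpha>\<in>\<mu> \<inter> active x. \<delta> \<alpha> y) + real (card (\<mu> \<inter> active x)) * d x y"
    by (simp add: sum.distrib)
  also have "(\<Sum>\<alpha>\<in>\<mu> \<inter> active x. \<delta> \<alpha> y) \<le> weight \<mu> y"
    using assms finite_active by (intro sum_depth_le_weight) auto
  finally show ?thesis by simp
qed

text \<open>The number of active indices is \<open>M\<close> at most, and the point is to save one of them. If all
\<open>M\<close> indices active at \<open>x\<close> lie in \<open>\<mu>\<close>, then the complement of \<open>\<mu>\<close> has no weight at \<open>x\<close>, so the
partial sum is 1 there and only the complement's gain at \<open>y\<close> matters; the case of \<open>y\<close> is
symmetric. Both cannot happen at once, since a set that is \<open>L\<close>-deep at \<open>x\<close> is active at \<open>y\<close>.\<close>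

lemma partial_sum_local_increase:
  assumes x: "x \<in> X" and y: "y \<in> X" and \<mu>: "\<mu> \<subseteq> K" and near: "d x y < L"
    and c: "0 < c" "\<And>z. z \<in> X \<Longrightarrow> c \<le> weight K z"
  shows "std_pou_partial_sum X d K U \<mu> x - std_pou_partial_sum X d K U \<mu> y
           \<le> (real M - 1) / c * d x y"
proof -
  let ?\<nu> = "K - \<mu>" and ?t = "(real M - 1) * d x y"
  let ?p = "card (\<mu> \<inter> active x)" and ?q = "card (?\<nu> \<inter> active y)"
  have D: "0 \<le> d x y" by (rule nonneg)
  have pa: "weight \<mu> x - weight \<mu> y \<le> real ?p * d x y"
    using weight_diff_le x y \<mu> by blast
  have qb: "weight ?\<nu> y - weight ?\<nu> x \<le> real ?q * d x y"
    using weight_diff_le[of y x ?\<nu>] x y commute by auto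
  have small: "k < M \<Longrightarrow> u \<le> real k * d x y \<Longrightarrow> u \<le> ?t" for k u
    using mult_right_mono[OF _ D, of "real k" "real M - 1"] by force
  have cx: "c \<le> weight \<mu> x + weight ?\<nu> x" and cy: "c \<le> weight \<mu> y + weight ?\<nu> y"
    using c(2) weight_split x y \<mu> by metis+
  have pos: "0 \<le> weight \<mu> x" "0 \<le> weight ?\<nu> x" "0 \<le> weight \<mu> y" "0 \<le> weight ?\<nu> y"
    by (rule weight_nonneg)+
  have notboth: "?p < M \<or> ?q < M"
  proof (rule ccontr)
    assume "\<not> ?thesis"
    then have sub: "active x \<subseteq> \<mu>" "active y \<subseteq> ?\<nu>"
      using card_inter_active x y active_subset_of_card_eq by (metis linorder_neqE_nat not_less)+
    obtain \<alpha> where \<alpha>: "\<alpha> \<in> active x" "L \<le> \<delta> \<alpha> x" using ex_deep[OF x] by blast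
    then have "\<alpha> \<in> K" by (simp add: active_def)
    then have "0 < \<delta> \<alpha> y"
      using depth_Lipschitz[OF x y proper, of \<alpha>] \<alpha>(2) near by simp
    then have "\<alpha> \<in> active y" using inactive_depth[OF y \<open>\<alpha> \<in> K\<close>] by force
    then show False using sub \<alpha> by blast
  qed
  have t: "0 \<le> ?t" using notboth D by (intro mult_nonneg_nonneg) auto
  have "weight \<mu> x / (weight \<mu> x + weight ?\<nu> x) - weight \<mu> y / (weight \<mu> y + weight ?\<nu> y)
          \<le> ?t / c"
  proof (cases "?p < M \<and> ?q < M")
    case True
    then show ?thesis
      using small[OF _ pa] small[OF _ qb]
      by (intro normalized_diff_le pos c(1) cx cy t) auto
  next
    case False
    then consider "\<not> ?p < M" "?q < M" | "?p < M" "\<not> ?q < M" using notboth by blast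
    then show ?thesis
    proof cases
      case 1
      then have "active x \<subseteq> \<mu>"
        using card_inter_active[OF x, of \<mu>] active_subset_of_card_eq[OF x] by simp
      then have z: "weight ?\<nu> x = 0" by (intro weight_disjoint_active) blast
      have "weight \<mu> x / (weight \<mu> x + weight ?\<nu> x) - weight \<mu> y / (weight \<mu> y + weight ?\<nu> y)
          = weight ?\<nu> y / (weight \<mu> y + weight ?\<nu> y)"
        using z cx cy c(1) by (simp add: field_simps)
      also have "\<dots> \<le> ?t / c"
        using small[OF 1(2) qb] z pos c(1) cy t by (intro frac_le) auto
      finally show ?thesis .
    next
      case 2
      then have "active y \<subseteq> ?\<nu>"
        using card_inter_active[OF y, of ?\<nu>] active_subset_of_card_eq[OF y] by simp
      then have z: "weight \<mu> y = 0" by (intro weight_disjoint_active) blast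
      have "weight \<mu> x / (weight \<mu> x + weight ?\<nu> x) \<le> ?t / c"
        using small[OF 2(1) pa] z pos c(1) cx t by (intro frac_le) auto
      then show ?thesis using z by simp
    qed
  qed
  then show ?thesis
    using partial_sum_eq_weight[OF x \<mu>] partial_sum_eq_weight[OF y \<mu>]
      weight_split[OF x \<mu>] weight_split[OF y \<mu>] by simp
qed

lemma partial_sum_local_Lipschitz:
  assumes "x \<in> X" "y \<in> X" "\<mu> \<subseteq> K" "d x y < L"
    and "0 < c" "\<And>z. z \<in> X \<Longrightarrow> c \<le> weight K z"
  shows "\<bar>std_pou_partial_sum X d K U \<mu> x - std_pou_partial_sum X d K U \<mu> y\<bar>
           \<le> (real M - 1) / c * d x y"
proof -
  have yx: "d y x < L" using assms(4) commute[of x y] by simp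
  show ?thesis
    using partial_sum_local_increase[OF assms] commute[of x y]
      partial_sum_local_increase[OF assms(2,1,3) yx assms(5,6)] by (simp add: abs_le_iff)
qed

lemma partial_sum_unit_interval:
  assumes "x \<in> X" "\<mu> \<subseteq> K"
  shows "0 \<le> std_pou_partial_sum X d K U \<mu> x" "std_pou_partial_sum X d K U \<mu> x \<le> 1"
proof -
  have "0 < weight K x" using total_ge[OF assms(1)] L_pos by simp
  then show "0 \<le> std_pou_partial_sum X d K U \<mu> x" "std_pou_partial_sum X d K U \<mu> x \<le> 1"
    using partial_sum_eq_weight[OF assms] weight_split[OF assms] weight_nonneg by simp_all
qed

lemma partial_sum_Lipschitz:
  assumes x: "x \<in> X" and y: "y \<in> X" and \<mu>: "\<mu> \<subseteq> K"
  shows "\<bar>std_pou_partial_sum X d K U \<mu> x - std_pou_partial_sum X d K U \<mu> y\<bar>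
           \<le> max 1 (real M - 1) / L * d x y"
proof (cases "d x y < L")
  case True
  then have "\<bar>std_pou_partial_sum X d K U \<mu> x - std_pou_partial_sum X d K U \<mu> y\<bar>
           \<le> (real M - 1) / L * d x y"
    using partial_sum_local_Lipschitz x y \<mu> L_pos total_ge by blast
  also have "\<dots> \<le> max 1 (real M - 1) / L * d x y"
    using L_pos by (intro mult_right_mono divide_right_mono) auto
  finally show ?thesis .
next
  case False
  have "\<bar>std_pou_partial_sum X d K U \<mu> x - std_pou_partial_sum X d K U \<mu> y\<bar> \<le> 1"
    using partial_sum_unit_interval[OF x \<mu>] partial_sum_unit_interval[OF y \<mu>] by simp
  also have "1 \<le> 1 / L * d x y" using False L_pos by (simp add: field_simps)
  also have "\<dots> \<le> max 1 (real M - 1) / L * d x y"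
    using L_pos by (intro mult_right_mono divide_right_mono) auto
  finally show ?thesis .
qed

text \<open>Let \<open>\<alpha>\<close> be \<open>L\<close>-deep at \<open>x\<close>, and follow a chain from \<open>x\<close> to an almost nearest point \<open>y\<close> outside
\<open>U \<alpha>\<close>. Just before the first place \<open>f k\<close> where \<open>\<alpha>\<close> is not \<open>L\<close>-deep, the remaining distance to
\<open>y\<close> is still at least \<open>L\<close>, so the chain has covered at most about \<open>\<delta> \<alpha> x - L\<close>. Some other \<open>\<beta>\<close>
is \<open>L\<close>-deep at \<open>f k\<close>, hence at \<open>x\<close> it has depth about \<open>2 * L - \<delta> \<alpha> x\<close> or more.\<close>

lemma total_ge_approx_midpoint:
  assumes mid: "approx_midpoint_property X d" and x: "x \<in> X"
  shows "2 * L \<le> weight K x"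
proof (rule field_le_epsilon)
  fix e :: real assume "0 < e"
  then have e: "0 < e / 3" by simp
  obtain \<alpha> where \<alpha>: "\<alpha> \<in> active x" "L \<le> \<delta> \<alpha> x" using ex_deep[OF x] by blast
  then have "\<alpha> \<in> K" by (simp add: active_def)
  then have ne: "X - U \<alpha> \<noteq> {}" by (rule proper)
  obtain y where y: "y \<in> X - U \<alpha>" "d x y < \<delta> \<alpha> x + e / 3"
    using depth_greatest[OF ne, of "\<delta> \<alpha> x + e / 3" x] e by fastforce
  then have yX: "y \<in> X" by simp
  obtain f n h where f: "f 0 = x" "f n = y" "\<And>i. f i \<in> X"
    "\<And>i. i < n \<Longrightarrow> d (f i) (f (Suc i)) \<le> h" "h \<le> e / 3" "real n * h \<le> d x y + e / 3"
    using approx_midpoint_fine_chain[OF mid e x yX] by blast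
  define k where "k = (LEAST k. \<delta> \<alpha> (f k) < L)"
  have "\<delta> \<alpha> (f n) < L" using depth_outside[OF yX, of "U \<alpha>"] f(2) y(1) L_pos by simp
  then have k: "\<delta> \<alpha> (f k) < L" "k \<le> n" unfolding k_def by (rule LeastI, rule Least_le)
  then have "k \<noteq> 0" using \<alpha>(2) f(1) by (metis not_less)
  then obtain j where j: "k = Suc j" by (cases k) auto
  then have "L \<le> \<delta> \<alpha> (f j)"
    using not_less_Least[of j "\<lambda>k. \<delta> \<alpha> (f k) < L"] unfolding k_def[symmetric] by simp
  also have "\<dots> \<le> d (f j) (f n)" using depth_le f(2,3) y(1) by simp
  also have "\<dots> \<le> (real n - real j) * h" using chain_dist_le f(3,4) j k(2) by force
  finally have "real k * h \<le> d x y + e / 3 + h - L"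
    using f(6) by (simp add: j algebra_simps)
  then have "d x (f k) \<le> d x y + e / 3 + h - L"
    using chain_dist_le[of f n h 0 k] f k(2) by force
  moreover obtain \<beta> where \<beta>: "\<beta> \<in> active (f k)" "L \<le> \<delta> \<beta> (f k)"
    using ex_deep[OF f(3)] by blast
  moreover have "\<delta> \<beta> (f k) \<le> \<delta> \<beta> x + d x (f k)"
    using depth_Lipschitz[OF f(3) x proper, of \<beta> k] commute[of x "f k"] \<beta>(1)
    by (simp add: active_def)
  ultimately have "2 * L \<le> \<delta> \<alpha> x + \<delta> \<beta> x + e" using y(2) f(5) by simp
  also have "\<delta> \<alpha> x + \<delta> \<beta> x = (\<Sum>\<gamma>\<in>{\<alpha>, \<beta>}. \<delta> \<gamma> x)"
  proof -
    have "\<alpha> \<noteq> \<beta>" using k(1) \<beta>(2) by auto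
    then show ?thesis by simp
  qed
  also have "\<dots> \<le> weight K x"
    using \<open>\<alpha> \<in> K\<close> \<beta>(1) x by (intro sum_depth_le_weight) (auto simp: active_def)
  finally show "2 * L \<le> weight K x + e" by simp
qed

lemma partial_sum_Lipschitz_approx_midpoint:
  assumes mid: "approx_midpoint_property X d" and "1 \<le> M" "x \<in> X" "y \<in> X" "\<mu> \<subseteq> K"
  shows "\<bar>std_pou_partial_sum X d K U \<mu> x - std_pou_partial_sum X d K U \<mu> y\<bar>
           \<le> (real M - 1) / (2 * L) * d x y"
proof (rule approx_midpoint_Lipschitz_of_local[OF mid L_pos])
  show "0 \<le> (real M - 1) / (2 * L)" using assms(2) L_pos by simp
  show "\<bar>std_pou_partial_sum X d K U \<mu> x - std_pou_partial_sum X d K U \<mu> y\<bar>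
           \<le> (real M - 1) / (2 * L) * d x y" if "x \<in> X" "y \<in> X" "d x y < L" for x y
    using partial_sum_local_Lipschitz total_ge_approx_midpoint[OF mid] that assms(5) L_pos
    by simp
qed (use assms in auto)

end

section \<open>Sharpness\<close>

lemma Metric_space_dist: "Metric_space X (dist :: real \<Rightarrow> real \<Rightarrow> real)"
  by (rule Met_TC.subspace) simp

lemma mball_dist: "Metric_space.mball X dist x r = (if x \<in> X then X \<inter> ball x r else {})"
  for X :: "real set"
  unfolding Metric_space.mball_def[OF Metric_space_dist] by auto

lemma openin_mtopology_dist_finite:
  assumes "finite X" "V \<subseteq> X"
  shows "openin (Metric_space.mtopology X (dist :: real \<Rightarrow> real \<Rightarrow> real)) V"
proof -
  interpret Metric_space X "dist :: real \<Rightarrow> real \<Rightarrow> real" by (rule Metric_space_dist)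
  define W where "W = - (X - V)"
  have "open W" unfolding W_def using assms(1) by (intro open_Compl finite_imp_closed) simp
  have "\<exists>r>0. mball x r \<subseteq> V" if "x \<in> V" for x
  proof -
    have "x \<in> W" using that by (simp add: W_def)
    then obtain r where "0 < r" "ball x r \<subseteq> W"
      using \<open>open W\<close> open_contains_ball by blast
    then show ?thesis by (intro exI[of _ r]) (auto simp: mball_dist W_def)
  qed
  then show ?thesis using assms(2) by (simp add: openin_mtopology)
qed

lemma approx_midpoint_property_real: "approx_midpoint_property (UNIV :: real set) dist"
  unfolding approx_midpoint_property_def
proof (intro ballI allI impI)
  fix x y \<epsilon> :: real assume "0 < \<epsilon>"
  then show "\<exists>z\<in>UNIV. max (dist x z) (dist z y) \<le> dist x y / 2 + \<epsilon>"
    by (intro bexI[of _ "midpoint x y"]) (auto simp: dist_midpoint)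
qed

lemma std_pou_finite:
  assumes "finite K" "\<nexists>\<beta>. \<beta> \<in> K \<and> U \<beta> = X"
  shows "std_pou X d K U \<alpha> x = depth X d (U \<alpha>) x / (\<Sum>\<beta>\<in>K. depth X d (U \<beta>) x)"
  using assms by (simp add: std_pou_proper)

text \<open>In the examples the difference quotient at step \<open>D\<close> is at least \<open>N / (c + N * D)\<close>, which
tends to \<open>N / c\<close>.\<close>

lemma ex_small_step:
  fixes C N c r :: real
  assumes "0 < N" "0 < c" "0 < r" "C < N / c"
  obtains D where "0 < D" "D < r" "C * (c + N * D) < N"
proof -
  have "((\<lambda>D. C * (c + N * D)) \<longlongrightarrow> C * (c + N * 0)) (at_right 0)"
    by (intro tendsto_mult tendsto_add tendsto_const tendsto_ident_at)
  moreover have "C * (c + N * 0) < N" using assms by (simp add: field_simps)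
  ultimately have "\<forall>\<^sub>F D in at_right 0. C * (c + N * D) < N"
    by (rule order_tendstoD)
  moreover have "\<forall>\<^sub>F D in at_right 0. 0 < D \<and> D < r"
    using eventually_at_right_real[OF assms(3)] by simp
  ultimately have "\<forall>\<^sub>F D in at_right 0. 0 < D \<and> D < r \<and> C * (c + N * D) < N"
    by eventually_elim simp
  then obtain D where "0 < D \<and> D < r \<and> C * (c + N * D) < N"
    using eventually_happens'[OF trivial_limit_at_right_real] by blast
  then show thesis using that by blast
qed

text \<open>Two points at distance \<open>L\<close>, covered by singletons, force the constant \<open>1 / L\<close>: the partition
of unity jumps from 1 to 0.\<close>

lemma sharp_two_points:
  fixes L C :: real
  assumes "0 < L" "C < 1 / L" "1 \<le> M"
  shows "\<exists>(X :: real set) (d :: real \<Rightarrow> real \<Rightarrow> real) (K :: nat set) (U :: nat \<Rightarrow> real set).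
         Metric_space X d \<and> open_cover X d K U \<and> lebesgue_number X d K U L \<and>
         has_multiplicity X K U M \<and>
         (\<exists>\<alpha>\<in>K. \<exists>x\<in>X. \<exists>y\<in>X.
            \<bar>std_pou X d K U \<alpha> x - std_pou X d K U \<alpha> y\<bar> > C * d x y)"
proof -
  define X where "X = {0, L}"
  define K where "K = {0, 1 :: nat}"
  define U where "U i = (if i = 0 then {0} else {L})" for i :: nat
  interpret Metric_space X dist by (rule Metric_space_dist)
  have "open_cover X dist K U"
    unfolding open_cover_def
    by (auto simp: X_def K_def U_def intro!: openin_mtopology_dist_finite)
  moreover have "lebesgue_number X dist K U L"
    using assms(1) unfolding lebesgue_number_def mball_dist
    by (auto simp: X_def K_def U_def dist_real_def)
  moreover have "has_multiplicity X K U M"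
  proof -
    have "{\<alpha> \<in> K. x \<in> U \<alpha>} = (if x = 0 then {0} else {1})" if "x \<in> X" for x
      using that assms(1) by (auto simp: X_def K_def U_def)
    then show ?thesis using assms(3) by (simp add: has_multiplicity_def)
  qed
  moreover have "\<exists>\<alpha>\<in>K. \<exists>x\<in>X. \<exists>y\<in>X.
      \<bar>std_pou X dist K U \<alpha> x - std_pou X dist K U \<alpha> y\<bar> > C * dist x y"
  proof (rule bexI[of _ 0], rule bexI[of _ 0], rule bexI[of _ L])
    show "C * dist 0 L < \<bar>std_pou X dist K U 0 0 - std_pou X dist K U 0 L\<bar>"
    proof -
      have "\<nexists>\<beta>. \<beta> \<in> K \<and> U \<beta> = X" using assms(1) by (auto simp: X_def K_def U_def)
      then have pou: "std_pou X dist K U \<alpha> x =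
          depth X dist (U \<alpha>) x / (depth X dist (U 0) x + depth X dist (U 1) x)" for \<alpha> x
        by (subst std_pou_finite) (auto simp: K_def)
      have "depth X dist (U 0) 0 = L"
        using assms(1) by (intro depth_eqI[of _ L]) (auto simp: X_def U_def dist_real_def)
      moreover have "depth X dist (U 1) 0 = 0" "depth X dist (U 0) L = 0"
        by (rule depth_outside; use assms(1) in \<open>simp add: X_def U_def\<close>)+
      ultimately show ?thesis
        using assms by (simp add: pou field_simps)
    qed
  qed (use assms in \<open>simp_all add: K_def X_def\<close>)
  ultimately show ?thesis
    using Metric_space_dist[of X]
    by (intro exI[of _ X] exI[of _ dist] exI[of _ K] exI[of _ U] conjI)
qed

text \<open>The points are 0, \<open>D\<close> and \<open>L + D\<close>. The set \<open>{0, D}\<close> has depth \<open>L\<close> at \<open>D\<close>, and the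
\<open>M - 1\<close> copies of \<open>{D}\<close> have depth \<open>D\<close> there but do not contain 0. The last set
covers \<open>L + D\<close> and influences neither of the other points.\<close>

lemma sharp_three_points:
  fixes L C :: real
  assumes "0 < L" "2 \<le> M" "C < (real M - 1) / L"
  shows "\<exists>(X :: real set) (d :: real \<Rightarrow> real \<Rightarrow> real) (K :: nat set) (U :: nat \<Rightarrow> real set).
         Metric_space X d \<and> open_cover X d K U \<and> lebesgue_number X d K U L \<and>
         has_multiplicity X K U M \<and>
         (\<exists>\<alpha>\<in>K. \<exists>x\<in>X. \<exists>y\<in>X.
            \<bar>std_pou X d K U \<alpha> x - std_pou X d K U \<alpha> y\<bar> > C * d x y)"
proof -
  have N: "0 < real M - 1" using assms(2) by simp
  obtain D where D: "0 < D" "D < L" "C * (L + (real M - 1) * D) < real M - 1"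
    by (rule ex_small_step[OF N assms(1,1,3)])
  define X where "X = {0, D, L + D}"
  define K where "K = {..M}"
  define U where "U i = (if i = 0 then {0, D} else if i < M then {D} else {L + D})" for i
  interpret Metric_space X dist by (rule Metric_space_dist)
  have "open_cover X dist K U"
  proof -
    have "openin mtopology (U i)" for i
      by (rule openin_mtopology_dist_finite) (auto simp: X_def U_def)
    moreover have "(\<Union>i\<in>K. U i) = X"
    proof
      show "(\<Union>i\<in>K. U i) \<subseteq> X" by (auto simp: X_def U_def split: if_splits)
      have "U 0 \<union> U M = X" using assms(2) by (auto simp: X_def U_def)
      then show "X \<subseteq> (\<Union>i\<in>K. U i)" by (auto simp: K_def)
    qed
    ultimately show ?thesis by (simp add: open_cover_def)
  qed
  moreover have "lebesgue_number X dist K U L"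
  proof -
    have "\<exists>i\<in>K. mball x L \<subseteq> U i" if "x \<in> X" for x
    proof (cases "x = L + D")
      case True
      then have "mball x L \<subseteq> U M"
        using D assms(1,2) by (auto simp: mball_dist X_def U_def dist_real_def)
      then show ?thesis by (auto simp: K_def)
    next
      case False
      then have "mball x L \<subseteq> U 0"
        using that D assms(1) by (auto simp: mball_dist X_def U_def dist_real_def)
      then show ?thesis by (auto simp: K_def)
    qed
    then show ?thesis using assms(1) by (simp add: lebesgue_number_def)
  qed
  moreover have "has_multiplicity X K U M"
  proof -
    have "{i \<in> K. x \<in> U i} \<subseteq> (if x = L + D then {M} else {..<M})" for x
      using D assms by (auto simp: K_def U_def split: if_splits)
    moreover have "finite (if x = L + D then {M} else {..<M})"
      "card (if x = L + D then {M} else {..<M}) \<le> M" for x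
      using assms(2) by auto
    ultimately show ?thesis
      unfolding has_multiplicity_def by (meson card_mono finite_subset order_trans)
  qed
  moreover have "\<exists>\<alpha>\<in>K. \<exists>x\<in>X. \<exists>y\<in>X.
      \<bar>std_pou X dist K U \<alpha> x - std_pou X dist K U \<alpha> y\<bar> > C * dist x y"
  proof (rule bexI[of _ 0], rule bexI[of _ 0], rule bexI[of _ D])
    show "C * dist 0 D < \<bar>std_pou X dist K U 0 0 - std_pou X dist K U 0 D\<bar>"
    proof -
      have "L + D \<notin> U i \<or> 0 \<notin> U i" for i using D assms(1) by (auto simp: U_def)
      then have "U i \<noteq> X" for i unfolding X_def by blast
      then have pou: "std_pou X dist K U i x =
          depth X dist (U i) x / (\<Sum>j\<le>M. depth X dist (U j) x)" for i x
        by (subst std_pou_finite) (auto simp: K_def)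
      have split: "(\<Sum>j\<le>M. g j) = g 0 + (\<Sum>j\<in>{1..<M}. g j) + g M" for g :: "nat \<Rightarrow> real"
      proof -
        have "{..M} = insert 0 (insert M {1..<M})" using assms(2) by auto
        then show ?thesis using assms(2) by simp
      qed
      have at0: "depth X dist (U 0) 0 = L + D"
        using assms(1) D by (intro depth_eqI[of _ "L + D"]) (auto simp: X_def U_def dist_real_def)
      have out0: "depth X dist (U i) 0 = 0" if "0 < i" for i
        using that assms(1) D by (intro depth_outside) (auto simp: X_def U_def)
      have atD: "depth X dist (U 0) D = L"
        using assms(1) D by (intro depth_eqI[of _ "L + D"]) (auto simp: X_def U_def dist_real_def)
      have midD: "depth X dist (U i) D = D" if "i \<in> {1..<M}" for i
        using that assms(1) D by (intro depth_eqI[of _ 0]) (auto simp: X_def U_def dist_real_def)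
      have outD: "depth X dist (U M) D = 0"
        using assms D by (intro depth_outside) (auto simp: X_def U_def)
      have "std_pou X dist K U 0 0 = 1"
        using assms D by (simp add: pou split at0 out0)
      moreover have "std_pou X dist K U 0 D = L / (L + (real M - 1) * D)"
        using assms by (simp add: pou split atD midD outD of_nat_diff)
      moreover have "C * D < 1 - L / (L + (real M - 1) * D)"
      proof -
        have pos: "0 < L + (real M - 1) * D" using assms(1) D N by (simp add: add_pos_pos)
        then have "1 - L / (L + (real M - 1) * D) = (real M - 1) * D / (L + (real M - 1) * D)"
          by (simp add: field_simps)
        moreover have "C * D * (L + (real M - 1) * D) < (real M - 1) * D"
          using mult_strict_right_mono[OF D(3,1)] by (simp add: algebra_simps)
        ultimately show ?thesis using pos by (simp add: pos_less_divide_eq)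
      qed
      ultimately show ?thesis using D(1) by (simp add: dist_real_def)
    qed
  qed (use assms in \<open>simp_all add: K_def X_def\<close>)
  ultimately show ?thesis
    using Metric_space_dist[of X]
    by (intro exI[of _ X] exI[of _ dist] exI[of _ K] exI[of _ U] conjI)
qed

text \<open>For \<open>M = 1\<close> the bound is 0, and only negative constants have to be excluded. The points
compared must be distinct for this.\<close>

lemma sharp_single_set:
  fixes L C :: real
  assumes "0 < L" "C < 0" "1 \<le> M"
  shows "\<exists>(X :: real set) (d :: real \<Rightarrow> real \<Rightarrow> real) (K :: nat set) (U :: nat \<Rightarrow> real set).
         Metric_space X d \<and> approx_midpoint_property X d \<and>
         open_cover X d K U \<and> lebesgue_number X d K U L \<and>
         has_multiplicity X K U M \<and>
         (\<exists>\<alpha>\<in>K. \<exists>x\<in>X. \<exists>y\<in>X.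
            \<bar>std_pou X d K U \<alpha> x - std_pou X d K U \<alpha> y\<bar> > C * d x y)"
proof -
  define K where "K = {0 :: nat}"
  define U :: "nat \<Rightarrow> real set" where "U i = UNIV" for i
  have "open_cover UNIV dist K U"
    by (simp add: open_cover_def U_def K_def)
  moreover have "lebesgue_number UNIV dist K U L"
    using assms(1) by (simp add: lebesgue_number_def U_def K_def)
  moreover have "has_multiplicity UNIV K U M"
    using assms(3) by (simp add: has_multiplicity_def U_def K_def)
  moreover have "\<exists>\<alpha>\<in>K. \<exists>x\<in>UNIV. \<exists>y\<in>UNIV.
      \<bar>std_pou (UNIV :: real set) dist K U \<alpha> x - std_pou (UNIV :: real set) dist K U \<alpha> y\<bar> > C * dist x y"
  proof (rule bexI[of _ 0], rule bexI[of _ 0], rule bexI[of _ 1])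
    show "C * dist (0 :: real) 1 < \<bar>std_pou (UNIV :: real set) dist K U 0 0 - std_pou (UNIV :: real set) dist K U 0 1\<bar>"
      using assms(2) by (simp add: std_pou_def U_def K_def dist_real_def)
  qed (simp_all add: K_def)
  ultimately show ?thesis
    using Metric_space_dist[of UNIV] approx_midpoint_property_real
    by (intro exI[of _ UNIV] exI[of _ dist] exI[of _ K] exI[of _ U] conjI)
qed

text \<open>The set \<open>{..<2 * L}\<close> is alone at 0, where it has depth \<open>2 * L\<close>, and the \<open>M - 1\<close> copies of
\<open>{0<..}\<close> gain depth at unit rate to the right of 0. At and left of \<open>L\<close> the first set contains the
\<open>L\<close>-ball, right of \<open>L\<close> the others do.\<close>

lemma sharp_half_lines:
  fixes L C :: real
  assumes "0 < L" "2 \<le> M" "C < (real M - 1) / (2 * L)"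
  shows "\<exists>(X :: real set) (d :: real \<Rightarrow> real \<Rightarrow> real) (K :: nat set) (U :: nat \<Rightarrow> real set).
         Metric_space X d \<and> approx_midpoint_property X d \<and>
         open_cover X d K U \<and> lebesgue_number X d K U L \<and>
         has_multiplicity X K U M \<and>
         (\<exists>\<alpha>\<in>K. \<exists>x\<in>X. \<exists>y\<in>X.
            \<bar>std_pou X d K U \<alpha> x - std_pou X d K U \<alpha> y\<bar> > C * d x y)"
proof -
  have N: "0 < real M - 1" and L2: "0 < 2 * L" using assms(1,2) by simp_all
  obtain D where D: "0 < D" "D < 2 * L" "C * (2 * L + (real M - 1) * D) < real M - 1"
    by (rule ex_small_step[OF N L2 L2 assms(3)])
  define K where "K = {..<M}"
  define U where "U i = (if i = 0 then {..<2 * L} else {0<..})" for i :: nat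
  have "open_cover UNIV dist K U"
  proof -
    have "U 0 \<union> U 1 = UNIV" using assms(1) by (auto simp: U_def)
    moreover have "0 \<in> K" "1 \<in> K" using assms(2) by (simp_all add: K_def)
    ultimately have "(\<Union>i\<in>K. U i) = UNIV" by blast
    then show ?thesis by (simp add: open_cover_def U_def)
  qed
  moreover have "lebesgue_number UNIV dist K U L"
  proof -
    have "\<exists>i\<in>K. ball x L \<subseteq> U i" for x :: real
    proof (cases "x \<le> L")
      case True
      then have "ball x L \<subseteq> U 0" by (auto simp: U_def dist_real_def)
      then show ?thesis using assms(2) by (auto simp: K_def)
    next
      case False
      then have "ball x L \<subseteq> U 1" by (auto simp: U_def dist_real_def)
      then show ?thesis using assms(2) by (auto simp: K_def)
    qed
    then show ?thesis using assms(1) by (simp add: lebesgue_number_def)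
  qed
  moreover have "has_multiplicity UNIV K U M"
  proof -
    have "card {i \<in> K. x \<in> U i} \<le> card K" for x by (rule card_mono) (auto simp: K_def)
    then show ?thesis by (simp add: has_multiplicity_def K_def)
  qed
  moreover have "\<exists>\<alpha>\<in>K. \<exists>x\<in>UNIV. \<exists>y\<in>UNIV.
      \<bar>std_pou (UNIV :: real set) dist K U \<alpha> x - std_pou (UNIV :: real set) dist K U \<alpha> y\<bar> > C * dist x y"
  proof (rule bexI[of _ 0], rule bexI[of _ 0], rule bexI[of _ D])
    show "C * dist 0 D < \<bar>std_pou (UNIV :: real set) dist K U 0 0 - std_pou (UNIV :: real set) dist K U 0 D\<bar>"
    proof -
      have "U i \<noteq> UNIV" for i by (auto simp: U_def)
      then have pou: "std_pou (UNIV :: real set) dist K U i x =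
          depth UNIV dist (U i) x / (\<Sum>j<M. depth UNIV dist (U j) x)" for i x
        by (subst std_pou_finite) (auto simp: K_def)
      have split: "(\<Sum>j<M. g j) = g 0 + (\<Sum>j\<in>{1..<M}. g j)" for g :: "nat \<Rightarrow> real"
      proof -
        have "{..<M} = insert 0 {1..<M}" using assms(2) by auto
        then show ?thesis by simp
      qed
      have left: "depth UNIV dist (U 0) x = 2 * L - x" if "x \<le> 2 * L" for x
        using that by (intro Metric_space.depth_eqI[OF Metric_space_dist, where y = "2 * L"]) (auto simp: U_def dist_real_def)
      have right: "depth UNIV dist (U i) x = x" if "0 \<le> x" "i \<in> {1..<M}" for i x
        using that by (intro Metric_space.depth_eqI[OF Metric_space_dist, where y = 0]) (auto simp: U_def dist_real_def)
      have "std_pou (UNIV :: real set) dist K U 0 0 = 1"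
        using assms(1) by (simp add: pou split left right)
      moreover have "std_pou (UNIV :: real set) dist K U 0 D = (2 * L - D) / (2 * L - D + (real M - 1) * D)"
        using assms(2) D by (simp add: pou split left right of_nat_diff)
      moreover have "C * D < 1 - (2 * L - D) / (2 * L - D + (real M - 1) * D)"
      proof -
        let ?S = "2 * L - D + (real M - 1) * D"
        have pos: "0 < ?S" using D N by (simp add: add_pos_pos)
        have "C * ?S < real M - 1"
        proof (cases "0 \<le> C")
          case True
          then have "C * ?S \<le> C * (2 * L + (real M - 1) * D)"
            using D(1) by (intro mult_left_mono) auto
          then show ?thesis using D(3) by linarith
        next
          case False
          then have "C * ?S < 0" using pos by (simp add: mult_neg_pos)
          then show ?thesis using N by linarith
        qed
        from mult_strict_right_mono[OF this D(1)]
        have "C * D * ?S < (real M - 1) * D" by (simp add: algebra_simps)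
        moreover have "1 - (2 * L - D) / ?S = (real M - 1) * D / ?S"
          using pos by (simp add: field_simps)
        ultimately show ?thesis using pos by (simp add: pos_less_divide_eq)
      qed
      ultimately show ?thesis using D(1) by (simp add: dist_real_def)
    qed
  qed (use assms in \<open>simp_all add: K_def\<close>)
  ultimately show ?thesis
    using Metric_space_dist[of UNIV] approx_midpoint_property_real
    by (intro exI[of _ UNIV] exI[of _ dist] exI[of _ K] exI[of _ U] conjI)
qed

section \<open>Covers containing the whole space, and the full statement\<close>

lemma std_pou_degenerate:
  assumes "\<beta> \<in> K" "U \<beta> = X"
  shows "std_pou X d K U \<alpha> x = std_pou X d K U \<alpha> y"
  using assms by (auto simp: std_pou_def)

text \<open>If some member of the cover is the whole space, the partition of unity is constant. Otherwise
the bounds for proper covers apply.\<close>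

lemma partial_sum_bound:
  fixes X :: "'a set" and K :: "'k set"
  assumes "Metric_space X d" and cover: "open_cover X d K U" and leb: "lebesgue_number X d K U L"
    and mult: "has_multiplicity X K U M" and M: "1 \<le> M"
    and "\<mu> \<subseteq> K" "x \<in> X" "y \<in> X"
  shows "\<bar>std_pou_partial_sum X d K U \<mu> x - std_pou_partial_sum X d K U \<mu> y\<bar>
           \<le> max 1 (real M - 1) / L * d x y" (is ?general)
    and "approx_midpoint_property X d \<Longrightarrow>
         \<bar>std_pou_partial_sum X d K U \<mu> x - std_pou_partial_sum X d K U \<mu> y\<bar>
           \<le> (real M - 1) / (2 * L) * d x y" (is "_ \<Longrightarrow> ?midpoint")
proof -
  interpret Metric_space X d by fact
  have "?general \<and> (approx_midpoint_property X d \<longrightarrow> ?midpoint)"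
  proof (cases "\<exists>\<beta>\<in>K. U \<beta> = X")
    case True
    then have "std_pou X d K U \<alpha> x = std_pou X d K U \<alpha> y" for \<alpha>
      using std_pou_degenerate by metis
    then have "std_pou_partial_sum X d K U \<mu> x = std_pou_partial_sum X d K U \<mu> y"
      by (simp add: std_pou_partial_sum_def)
    moreover have "0 < L" using leb by (simp add: lebesgue_number_def)
    ultimately show ?thesis using M by simp
  next
    case False
    have "X - U \<alpha> \<noteq> {}" if "\<alpha> \<in> K" for \<alpha>
      using that cover False by (auto simp: open_cover_def)
    then interpret proper_cover X d K U L M
      by unfold_locales (use leb mult in auto)
    show ?thesis
      using partial_sum_Lipschitz partial_sum_Lipschitz_approx_midpoint assms(5-8) by simp
  qed
  then show ?general and "approx_midpoint_property X d \<Longrightarrow> ?midpoint" by simp_all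
qed

theorem mainTheorem1:
  "(\<forall>(X :: 'a set) (d :: 'a \<Rightarrow> 'a \<Rightarrow> real) (K :: 'k set) (U :: 'k \<Rightarrow> 'a set) (L :: real) (M :: nat).
      Metric_space X d \<longrightarrow> open_cover X d K U \<longrightarrow> lebesgue_number X d K U L \<longrightarrow>
      has_multiplicity X K U M \<longrightarrow> 1 \<le> M \<longrightarrow>
        (\<forall>\<alpha>\<in>K. \<forall>x\<in>X. \<forall>y\<in>X.
           \<bar>std_pou X d K U \<alpha> x - std_pou X d K U \<alpha> y\<bar> \<le> max 1 (real M - 1) / L * d x y) \<and>
        (\<forall>\<mu>. \<mu> \<subseteq> K \<longrightarrow> (\<forall>x\<in>X. \<forall>y\<in>X.
           \<bar>std_pou_partial_sum X d K U \<mu> x - std_pou_partial_sum X d K U \<mu> y\<bar>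
             \<le> max 1 (real M - 1) / L * d x y)) \<and>
        (approx_midpoint_property X d \<longrightarrow>
          (\<forall>\<alpha>\<in>K. \<forall>x\<in>X. \<forall>y\<in>X.
             \<bar>std_pou X d K U \<alpha> x - std_pou X d K U \<alpha> y\<bar> \<le> (real M - 1) / (2 * L) * d x y) \<and>
          (\<forall>\<mu>. \<mu> \<subseteq> K \<longrightarrow> (\<forall>x\<in>X. \<forall>y\<in>X.
             \<bar>std_pou_partial_sum X d K U \<mu> x - std_pou_partial_sum X d K U \<mu> y\<bar>
               \<le> (real M - 1) / (2 * L) * d x y)))) \<and>
   (\<forall>(M :: nat) (L :: real) (C :: real). 1 \<le> M \<longrightarrow> 0 < L \<longrightarrow> C < max 1 (real M - 1) / L \<longrightarrow>
      (\<exists>(X :: real set) (d :: real \<Rightarrow> real \<Rightarrow> real) (K :: nat set) (U :: nat \<Rightarrow> real set).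
         Metric_space X d \<and> open_cover X d K U \<and> lebesgue_number X d K U L \<and>
         has_multiplicity X K U M \<and>
         (\<exists>\<alpha>\<in>K. \<exists>x\<in>X. \<exists>y\<in>X.
            \<bar>std_pou X d K U \<alpha> x - std_pou X d K U \<alpha> y\<bar> > C * d x y))) \<and>
   (\<forall>(M :: nat) (L :: real) (C :: real). 1 \<le> M \<longrightarrow> 0 < L \<longrightarrow> C < (real M - 1) / (2 * L) \<longrightarrow>
      (\<exists>(X :: real set) (d :: real \<Rightarrow> real \<Rightarrow> real) (K :: nat set) (U :: nat \<Rightarrow> real set).
         Metric_space X d \<and> approx_midpoint_property X d \<and>
         open_cover X d K U \<and> lebesgue_number X d K U L \<and>
         has_multiplicity X K U M \<and>
         (\<exists>\<alpha>\<in>K. \<exists>x\<in>X. \<exists>y\<in>X.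
            \<bar>std_pou X d K U \<alpha> x - std_pou X d K U \<alpha> y\<bar> > C * d x y)))"
proof (intro conjI allI impI ballI)
  fix X :: "'a set" and d and K :: "'k set" and U L M
  assume *: "Metric_space X d" "open_cover X d K U" "lebesgue_number X d K U L"
    "has_multiplicity X K U M" "1 \<le> M"
  fix x y assume xy: "x \<in> X" "y \<in> X"
  show "\<bar>std_pou_partial_sum X d K U \<mu> x - std_pou_partial_sum X d K U \<mu> y\<bar>
      \<le> max 1 (real M - 1) / L * d x y" if "\<mu> \<subseteq> K" for \<mu>
    using * that xy by (rule partial_sum_bound(1))
  show "\<bar>std_pou_partial_sum X d K U \<mu> x - std_pou_partial_sum X d K U \<mu> y\<bar>
      \<le> (real M - 1) / (2 * L) * d x y" if "approx_midpoint_property X d" "\<mu> \<subseteq> K" for \<mu>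
    using * that(2) xy that(1) by (rule partial_sum_bound(2))
  show "\<bar>std_pou X d K U \<alpha> x - std_pou X d K U \<alpha> y\<bar> \<le> max 1 (real M - 1) / L * d x y"
    if "\<alpha> \<in> K" for \<alpha>
    using partial_sum_bound(1)[OF * _ xy, of "{\<alpha>}"] that
    by (simp add: std_pou_partial_sum_singleton)
  show "\<bar>std_pou X d K U \<alpha> x - std_pou X d K U \<alpha> y\<bar> \<le> (real M - 1) / (2 * L) * d x y"
    if "approx_midpoint_property X d" "\<alpha> \<in> K" for \<alpha>
    using partial_sum_bound(2)[OF * _ xy that(1), of "{\<alpha>}"] that
    by (simp add: std_pou_partial_sum_singleton)
next
  fix M :: nat and L C :: real
  assume "1 \<le> M" "0 < L" "C < max 1 (real M - 1) / L"
  then consider "C < 1 / L" | "2 \<le> M" "C < (real M - 1) / L"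
    by (cases "2 \<le> M") (auto simp: max_def split: if_splits)
  then show "\<exists>(X :: real set) (d :: real \<Rightarrow> real \<Rightarrow> real) (K :: nat set) (U :: nat \<Rightarrow> real set).
         Metric_space X d \<and> open_cover X d K U \<and> lebesgue_number X d K U L \<and>
         has_multiplicity X K U M \<and>
         (\<exists>\<alpha>\<in>K. \<exists>x\<in>X. \<exists>y\<in>X.
            \<bar>std_pou X d K U \<alpha> x - std_pou X d K U \<alpha> y\<bar> > C * d x y)"
  proof cases
    case 1
    show ?thesis by (rule sharp_two_points) fact+
  next
    case 2
    show ?thesis by (rule sharp_three_points) fact+
  qed
next
  fix M :: nat and L C :: real
  assume "1 \<le> M" "0 < L" "C < (real M - 1) / (2 * L)"
  then consider "C < 0" | "2 \<le> M"
    by (cases "M = 1") auto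
  then show "\<exists>(X :: real set) (d :: real \<Rightarrow> real \<Rightarrow> real) (K :: nat set) (U :: nat \<Rightarrow> real set).
         Metric_space X d \<and> approx_midpoint_property X d \<and>
         open_cover X d K U \<and> lebesgue_number X d K U L \<and>
         has_multiplicity X K U M \<and>
         (\<exists>\<alpha>\<in>K. \<exists>x\<in>X. \<exists>y\<in>X.
            \<bar>std_pou X d K U \<alpha> x - std_pou X d K U \<alpha> y\<bar> > C * d x y)"
  proof cases
    case 1
    show ?thesis by (rule sharp_single_set) fact+
  next
    case 2
    show ?thesis by (rule sharp_half_lines) fact+
  qed
qed

end
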